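(* Let $L$ be any lattice with a least element $0$, let $A(L)$ denote its set of atoms, and let $\delta\colon L\rightarrow \mathbb{R}_{\geq 0}$ be the function given by $$\delta(a)=\begin{cases} 0, & a\in A(L)\cup\{0\},\\ 1, & \text{otherwise.}\end{cases}$$ Then $(L,\delta)$ is a lattice diversity.
   Context: In a lattice $L$ with least element $0$, the atoms are the elements $a$ that cover $0$, i.e. $a>0$ and there is no $c\in L$ with $0<c<a$; $A(L)$ is the set of atoms. Lattice diversity: let $L$ be a lattice with least element $0$ and let $\delta\colon L\to\mathbb{R}_{\ge 0}$. The pair $(L,\delta)$ is a lattice diversity if for all $a,b\in L$: (1) $\delta(a)=0$ if and only if $a\in A(L)$ or $a=0$; (2) $a\le b$ implies $\delta(a)\le\delta(b)$; (3) $a\wedge b\ne 0$ implies $\delta(a\vee b)\le\delta(a)+\delta(b)$. *)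

theory Defs
  imports Complex_Main
begin

definition atoms :: "'a::bounded_lattice_bot set"
  where "atoms = {a. bot < a \<and> \<not> (\<exists>c. bot < c \<and> c < a)}"

text \<open>The lattice is the type \<open>'a\<close>; the codomain of non-negative reals is rendered as \<open>real\<close>
  together with an explicit non-negativity clause.\<close>

definition lattice_diversity :: "('a::bounded_lattice_bot \<Rightarrow> real) \<Rightarrow> bool"
  where "lattice_diversity \<delta> \<longleftrightarrow>
    (\<forall>a. 0 \<le> \<delta> a) \<and>
    (\<forall>a. \<delta> a = 0 \<longleftrightarrow> a \<in> atoms \<or> a = bot) \<and>
    (\<forall>a b. a \<le> b \<longrightarrow> \<delta> a \<le> \<delta> b) \<and>
    (\<forall>a b. inf a b \<noteq> bot \<longrightarrow> \<delta> (sup a b) \<le> \<delta> a + \<delta> b)"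

end

theory Submission
  imports Defs
begin

text \<open>Write \<open>Z\<close> for the zero set of \<open>\<delta>\<close>, the atoms together with the least element. Since \<open>\<delta>\<close>
  takes only the values \<open>0\<close> and \<open>1\<close>, monotonicity says exactly that \<open>Z\<close> is a down-set. The
  triangle inequality can fail only if \<open>a\<close> and \<open>b\<close> both lie in \<open>Z\<close> while their join does not;
  but a non-zero element below two atoms coincides with each of them, so two elements of \<open>Z\<close>
  with non-zero meet are equal, and their join lies in \<open>Z\<close> again.\<close>

lemma below_atom_eq:
  assumes "a \<in> atoms" and "c \<le> a" and "c \<noteq> bot"
  shows "c = a"
  using assms by (auto simp: atoms_def bot_less order_le_less)

lemma atoms_bot_downward_closed:
  assumes "b \<in> atoms \<union> {bot}" and "a \<le> b"
  shows "a \<in> atoms \<union> {bot}"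
  using assms below_atom_eq[of b a] by (cases "a = bot") (auto simp: bot_unique)

lemma atoms_bot_eq_if_inf_nonbot:
  assumes "a \<in> atoms \<union> {bot}" and "b \<in> atoms \<union> {bot}" and "inf a b \<noteq> bot"
  shows "a = b"
proof -
  have "a \<in> atoms" "b \<in> atoms"
    using assms by auto
  then have "inf a b = a" "inf a b = b"
    using below_atom_eq assms(3) by (metis inf_le1, metis inf_le2)
  then show ?thesis by simp
qed

theorem theorem5:
  fixes \<delta> :: "'a::bounded_lattice_bot \<Rightarrow> real"
  assumes "\<And>a. \<delta> a = (if a \<in> atoms \<union> {bot} then 0 else 1)"
  shows "lattice_diversity \<delta>"
proof -
  have nonneg: "0 \<le> \<delta> a" and zero: "\<delta> a = 0 \<longleftrightarrow> a \<in> atoms \<or> a = bot" for a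
    by (auto simp: assms)
  have mono: "\<delta> a \<le> \<delta> b" if "a \<le> b" for a b
    using atoms_bot_downward_closed[OF _ that] by (simp add: assms)
  have triangle: "\<delta> (sup a b) \<le> \<delta> a + \<delta> b" if "inf a b \<noteq> bot" for a b
  proof (cases "a \<in> atoms \<union> {bot} \<and> b \<in> atoms \<union> {bot}")
    case True
    then have "a = b"
      using atoms_bot_eq_if_inf_nonbot that by blast
    then show ?thesis
      using nonneg[of a] by simp
  next
    case False
    then show ?thesis
      by (auto simp: assms)
  qed
  show ?thesis
    unfolding lattice_diversity_def using nonneg zero mono triangle by blast
qed

end
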